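(* (a) For every $v\geq 8$ there exists a connected symmetric configuration $v_3$ whose minimum blocking set cardinality is exactly $\lceil v/3\rceil+1$. (b) For $v=12$ and for every $v\geq 15$ there exists a connected symmetric configuration $v_3$ whose minimum blocking set cardinality is exactly $\lceil v/3\rceil+2$.
   Context: A symmetric configuration $v_3$ consists of a set of $v$ points and a collection of $v$ blocks, each block being a 3-element subset of the points, such that every point lies in exactly 3 blocks and any two distinct points lie in at most one common block. It is connected if it is not the union of two configurations on disjoint nonempty point sets. A blocking set is a subset $Q$ of the points such that every block contains at least one point of $Q$ and at least one point not in $Q$. The minimum blocking set cardinality of a configuration is the smallest cardinality of a blocking set of it (assuming one exists). *)

theory Defs
  imports Complex_Main
begin

text \<open>A symmetric configuration v_3 on point set P with block set B.
  Blocks form a set (repeated blocks are impossible anyway, since two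
  distinct points lie in at most one common block).\<close>
definition sym_config_v3 :: "'a set \<Rightarrow> 'a set set \<Rightarrow> nat \<Rightarrow> bool" where
  "sym_config_v3 P B v \<longleftrightarrow>
     finite P \<and> card P = v \<and> finite B \<and> card B = v \<and>
     (\<forall>b\<in>B. b \<subseteq> P \<and> card b = 3) \<and>
     (\<forall>p\<in>P. card {b\<in>B. p \<in> b} = 3) \<and>
     (\<forall>p\<in>P. \<forall>q\<in>P. p \<noteq> q \<longrightarrow> card {b\<in>B. p \<in> b \<and> q \<in> b} \<le> 1)"

text \<open>Connected: not the union of two configurations on disjoint nonempty point sets,
  i.e. there is no splitting of P into two disjoint nonempty parts such that every block
  lies inside one of the parts.\<close>
definition config_connected :: "'a set \<Rightarrow> 'a set set \<Rightarrow> bool" where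
  "config_connected P B \<longleftrightarrow>
     \<not> (\<exists>P1 P2. P1 \<noteq> {} \<and> P2 \<noteq> {} \<and> P1 \<inter> P2 = {} \<and> P1 \<union> P2 = P \<and>
                (\<forall>b\<in>B. b \<subseteq> P1 \<or> b \<subseteq> P2))"

definition blocking_set :: "'a set \<Rightarrow> 'a set set \<Rightarrow> 'a set \<Rightarrow> bool" where
  "blocking_set P B Q \<longleftrightarrow> Q \<subseteq> P \<and> (\<forall>b\<in>B. b \<inter> Q \<noteq> {} \<and> b - Q \<noteq> {})"

definition min_blocking_card :: "'a set \<Rightarrow> 'a set set \<Rightarrow> nat \<Rightarrow> bool" where
  "min_blocking_card P B k \<longleftrightarrow>
     (\<exists>Q. blocking_set P B Q \<and> card Q = k) \<and>
     (\<forall>Q. blocking_set P B Q \<longrightarrow> k \<le> card Q)"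

end

theory Submission
  imports Defs
begin

text \<open>
  Call a block heavy for a blocking set \<open>Q\<close> if it contains two points of \<open>Q\<close>. Counting incidences gives
  \<open>3 * card Q = v + h\<close> with \<open>h\<close> the number of heavy blocks, so a lower bound on the size of a blocking
  set is a lower bound on \<open>h\<close>. If some set \<open>L\<close> of blocks already forces \<open>k\<close> heavy blocks
  among its members, the bound survives every change of the configuration outside \<open>L\<close>.

  Three pairwise disjoint blocks outside \<open>L\<close> can be traded for six blocks through three new points so
  that the blocking set grows by one point; the new blocks again contain three pairwise
  disjoint ones, so the step can be iterated. As it adds 3 to \<open>v\<close> and 1 to the minimum, one base
  configuration for each residue of \<open>v\<close> modulo 3 suffices, together with finitely
  many small configurations. The base configurations were found by simulated annealing, and their forced
  heavy blocks are verified by exhaustive search.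
\<close>

section \<open>Heavy blocks\<close>

definition heavy_blocks :: "'a set set \<Rightarrow> 'a set \<Rightarrow> 'a set set" where
  "heavy_blocks B Q = {b \<in> B. 2 \<le> card (b \<inter> Q)}"

definition bichromatic :: "'a set \<Rightarrow> 'a set \<Rightarrow> bool" where
  "bichromatic Q b \<longleftrightarrow> b \<inter> Q \<noteq> {} \<and> b - Q \<noteq> {}"

text \<open>\<open>Q\<close> ranges over all sets that split the members of \<open>L\<close>, not
  over blocking sets of a surrounding configuration, so the property transfers to every
  configuration containing \<open>L\<close>.\<close>

definition forces_heavy :: "'a set set \<Rightarrow> nat \<Rightarrow> bool" where
  "forces_heavy L k \<longleftrightarrow> (\<forall>Q. (\<forall>b\<in>L. bichromatic Q b) \<longrightarrow> k \<le> card (heavy_blocks L Q))"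

text \<open>Double counting of incidences between \<open>Q\<close> and \<open>B\<close>: each point
  of \<open>Q\<close> lies in three blocks, each block meets \<open>Q\<close> at least once, and
  each heavy member of \<open>L\<close> at least twice.\<close>

lemma sym_config_v3_card_blocking_ge:
  assumes C: "sym_config_v3 P B v" and L: "L \<subseteq> B" "forces_heavy L k"
    and Q: "blocking_set P B Q"
  shows "v + k \<le> 3 * card Q"
proof -
  have fin: "finite P" "finite B" "finite Q"
    using C Q by (auto simp: sym_config_v3_def blocking_set_def intro: finite_subset)
  have hit: "b \<inter> Q \<noteq> {}" "bichromatic Q b" "finite (b \<inter> Q)" if "b \<in> B" for b
    using that Q fin by (auto simp: blocking_set_def bichromatic_def)
  have "3 * card Q = (\<Sum>p\<in>Q. card {b\<in>B. p \<in> b})"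
    using C Q by (subst sum.cong[of _ Q _ "\<lambda>_. 3"]) (auto simp: sym_config_v3_def blocking_set_def)
  also have "\<dots> = (\<Sum>p\<in>Q. \<Sum>b\<in>B. if p \<in> b then 1 else 0)"
    using fin by (simp add: sum.If_cases Int_def)
  also have "\<dots> = (\<Sum>b\<in>B. \<Sum>p\<in>Q. if p \<in> b then 1 else 0)"
    by (rule sum.swap)
  also have "\<dots> = (\<Sum>b\<in>B. card (b \<inter> Q))"
    using fin by (simp add: sum.If_cases Int_def conj_commute)
  also have "\<dots> \<ge> (\<Sum>b\<in>B. 1 + (if b \<in> heavy_blocks L Q then 1 else 0))"
  proof (rule sum_mono)
    fix b assume b: "b \<in> B"
    show "1 + (if b \<in> heavy_blocks L Q then 1 else 0) \<le> card (b \<inter> Q)"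
      using hit[OF b] by (auto simp: heavy_blocks_def Suc_le_eq card_gt_0_iff)
  qed
  also have "(\<Sum>b\<in>B. 1 + (if b \<in> heavy_blocks L Q then 1 else 0)) = card B + card (heavy_blocks L Q)"
  proof -
    have "B \<inter> heavy_blocks L Q = heavy_blocks L Q"
      using L by (auto simp: heavy_blocks_def)
    then show ?thesis
      using fin by (simp only: sum.distrib) (simp add: sum.If_cases)
  qed
  finally have "card B + card (heavy_blocks L Q) \<le> 3 * card Q" .
  moreover have "k \<le> card (heavy_blocks L Q)"
    using L(2) hit(2) subsetD[OF L(1)] unfolding forces_heavy_def by blast
  moreover have "card B = v"
    using C by (simp add: sym_config_v3_def)
  ultimately show ?thesis by linarith
qed

text \<open>Cardinalities are integers: a blocking set smaller than \<open>Q\<close> would have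
  \<open>3 * card Q' \<le> 3 * card Q - 3 < v + k\<close>, against the counting bound.\<close>

lemma min_blocking_card_if_forces_heavy:
  assumes "sym_config_v3 P B v" "L \<subseteq> B" "forces_heavy L k"
    and "blocking_set P B Q" "3 * card Q < v + k + 3"
  shows "min_blocking_card P B (card Q)"
  unfolding min_blocking_card_def
proof (intro conjI allI impI)
  show "\<exists>Q'. blocking_set P B Q' \<and> card Q' = card Q" using assms by blast
next
  fix Q' assume "blocking_set P B Q'"
  then have "v + k \<le> 3 * card Q'"
    using sym_config_v3_card_blocking_ge assms by blast
  then show "card Q \<le> card Q'" using assms by linarith
qed

lemma card_common_blocks_le_1_iff:
  assumes "finite B"
  shows "card {b\<in>B. p \<in> b \<and> q \<in> b} \<le> Suc 0 \<longleftrightarrow>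
    (\<forall>b\<in>B. \<forall>b'\<in>B. p \<in> b \<longrightarrow> q \<in> b \<longrightarrow> p \<in> b' \<longrightarrow> q \<in> b' \<longrightarrow> b = b')"
  using assms by (subst card_le_Suc0_iff_eq) auto

lemma Collect_insert_conj:
  "{e. e \<in> insert u S \<and> R e} = (if R u then insert u {e\<in>S. R e} else {e\<in>S. R e})"
  by auto

text \<open>Provides the labelling that the exchange of blocks expects: \<open>a\<close> inside
  \<open>Q\<close>, \<open>c\<close> outside, the colour of \<open>b\<close> left open.\<close>

lemma bichromatic_triple:
  assumes "card A = 3" "bichromatic Q A"
  obtains a b c where "A = {a, b, c}" "distinct [a, b, c]" "a \<in> Q" "c \<notin> Q"
proof -
  obtain x y z where A: "A = {x, y, z}" "x \<noteq> y" "y \<noteq> z" "x \<noteq> z"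
    using assms(1) by (auto simp: card_3_iff)
  obtain a c where ac: "a \<in> A" "a \<in> Q" "c \<in> A" "c \<notin> Q"
    using assms(2) by (auto simp: bichromatic_def)
  then have "card (A - {a, c}) = 1"
    using assms(1) A by (subst card_Diff_subset) auto
  then obtain b where b: "A - {a, c} = {b}" by (auto simp: card_1_singleton_iff)
  show thesis
    by (rule that[of a b c]) (use b ac in auto)
qed

section \<open>Adding three points\<close>

text \<open>Six blocks through three new points replace three pairwise disjoint ones; the only pairs of
  old points that the new blocks join were joined by the old blocks, so no further
  condition on the old blocks is needed.\<close>

locale three_disjoint_blocks =
  fixes P :: "'a set" and B and v and x y z a b c a' b' c' a'' b'' c'' :: 'a
  assumes config: "sym_config_v3 P B v"
    and blocks: "{a, b, c} \<in> B" "{a', b', c'} \<in> B" "{a'', b'', c''} \<in> B"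
    and dist: "distinct [a, b, c, a', b', c', a'', b'', c'']"
    and fresh: "x \<notin> P" "y \<notin> P" "z \<notin> P" "distinct [x, y, z]"
begin

definition "Old = {{a, b, c}, {a', b', c'}, {a'', b'', c''}}"
text \<open>In each old block one pair stays together and receives one new point (\<open>b\<close>,
  \<open>c\<close> with \<open>x\<close>; \<open>a'\<close>, \<open>b'\<close> with
  \<open>y\<close>; \<open>a''\<close>, \<open>b''\<close> with \<open>z\<close>), while the third
  point receives two. Thus each old point keeps its degree and every pair of new points is joined
  exactly once.\<close>

definition "New = {{a, y, z}, {a', y, b'}, {a'', z, b''}, {x, y, c''}, {x, z, c'}, {x, b, c}}"
definition "P' = insert x (insert y (insert z P))"
definition "B' = (B - Old) \<union> New"

section \<open>Incidences after the exchange\<close>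

lemma old_points: "{a, b, c, a', b', c', a'', b'', c''} \<subseteq> P"
proof -
  have "e \<subseteq> P" if "e \<in> B" for e
    using config that by (simp add: sym_config_v3_def)
  from this[OF blocks(1)] this[OF blocks(2)] this[OF blocks(3)] show ?thesis by simp
qed

lemma neq_old:
  "a \<noteq> b" "a \<noteq> c" "a \<noteq> a'" "a \<noteq> b'" "a \<noteq> c'" "a \<noteq> a''"
  "a \<noteq> b''" "a \<noteq> c''" "b \<noteq> c" "b \<noteq> a'" "b \<noteq> b'" "b \<noteq> c'"
  "b \<noteq> a''" "b \<noteq> b''" "b \<noteq> c''" "c \<noteq> a'" "c \<noteq> b'"
  "c \<noteq> c'" "c \<noteq> a''" "c \<noteq> b''" "c \<noteq> c''" "a' \<noteq> b'"
  "a' \<noteq> c'" "a' \<noteq> a''" "a' \<noteq> b''" "a' \<noteq> c''" "b' \<noteq> c'"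
  "b' \<noteq> a''" "b' \<noteq> b''" "b' \<noteq> c''" "c' \<noteq> a''" "c' \<noteq> b''"
  "c' \<noteq> c''" "a'' \<noteq> b''" "a'' \<noteq> c''" "b'' \<noteq> c''"
  using dist by simp_all

lemma neq_fresh:
  "x \<noteq> y" "x \<noteq> z" "y \<noteq> z" "x \<noteq> a" "x \<noteq> b" "x \<noteq> c"
  "x \<noteq> a'" "x \<noteq> b'" "x \<noteq> c'" "x \<noteq> a''" "x \<noteq> b''"
  "x \<noteq> c''" "y \<noteq> a" "y \<noteq> b" "y \<noteq> c" "y \<noteq> a'" "y \<noteq> b'"
  "y \<noteq> c'" "y \<noteq> a''" "y \<noteq> b''" "y \<noteq> c''" "z \<noteq> a" "z \<noteq> b"
  "z \<noteq> c" "z \<noteq> a'" "z \<noteq> b'" "z \<noteq> c'" "z \<noteq> a''" "z \<noteq> b''"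
  "z \<noteq> c''"
  using fresh old_points by auto

text \<open>Inequalities in both orientations let the simplifier decide every comparison of explicit
  triples.\<close>

lemmas neqs = neq_old neq_old[symmetric] neq_fresh neq_fresh[symmetric]

lemma fin: "finite P" "finite B" "finite New" "finite Old"
  using config by (auto simp: sym_config_v3_def New_def Old_def)

lemma subP: "e \<in> B \<Longrightarrow> e \<subseteq> P"
  using config by (simp add: sym_config_v3_def)

lemma New_meets: "e \<in> New \<Longrightarrow> e \<inter> {x, y, z} \<noteq> {}"
  by (auto simp: New_def)

lemma New_disjoint: "B \<inter> New = {}"
  using New_meets subP fresh by blast

lemma distinct_New: "distinct [{a, y, z}, {a', y, b'}, {a'', z, b''}, {x, y, c''}, {x, z, c'}, {x, b, c}]"
  by (simp add: neqs set_eq_subset)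

lemma card_New: "card New = 6"
proof -
  from distinct_New have "card (set [{a, y, z}, {a', y, b'}, {a'', z, b''}, {x, y, c''}, {x, z, c'}, {x, b, c}]) = 6"
    by (subst distinct_card) simp_all
  then show ?thesis by (simp add: New_def)
qed

lemma card_blocks: "card B' = v + 3"
proof -
  have "Old \<subseteq> B" using blocks by (auto simp: Old_def)
  moreover have "card Old = 3"
    by (simp add: neqs Old_def card_insert_if set_eq_subset)
  ultimately have "card (B - Old) = v - 3" "3 \<le> v"
    using fin config card_mono[of B Old] by (auto simp: card_Diff_subset sym_config_v3_def)
  then show ?thesis
    unfolding B'_def using fin New_disjoint card_New by (subst card_Un_disjoint) auto
qed

lemma New_subset: "e \<in> New \<Longrightarrow> e \<subseteq> P'"
  using old_points unfolding New_def P'_def by auto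

lemma New_at_fresh:
  "{e\<in>New. x \<in> e} = {{x, y, c''}, {x, z, c'}, {x, b, c}}"
  "{e\<in>New. y \<in> e} = {{a, y, z}, {a', y, b'}, {x, y, c''}}"
  "{e\<in>New. z \<in> e} = {{a, y, z}, {a'', z, b''}, {x, z, c'}}"
  unfolding New_def Collect_insert_conj by (simp_all add: neqs)

lemma New_at_fresh_pair:
  "{e\<in>New. x \<in> e \<and> y \<in> e} = {{x, y, c''}}" "{e\<in>New. x \<in> e \<and> z \<in> e} = {{x, z, c'}}"
  "{e\<in>New. y \<in> e \<and> z \<in> e} = {{a, y, z}}"
  unfolding New_def Collect_insert_conj by (simp_all add: neqs)

lemma New_at:
  "{e\<in>New. a \<in> e} = {{a, y, z}}" "{e\<in>New. b \<in> e} = {{x, b, c}}"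
  "{e\<in>New. c \<in> e} = {{x, b, c}}" "{e\<in>New. a' \<in> e} = {{a', y, b'}}"
  "{e\<in>New. b' \<in> e} = {{a', y, b'}}" "{e\<in>New. c' \<in> e} = {{x, z, c'}}"
  "{e\<in>New. a'' \<in> e} = {{a'', z, b''}}" "{e\<in>New. b'' \<in> e} = {{a'', z, b''}}"
  "{e\<in>New. c'' \<in> e} = {{x, y, c''}}"
  unfolding New_def Collect_insert_conj by (simp_all add: neqs)

lemma Old_at:
  "{e\<in>Old. a \<in> e} = {{a, b, c}}" "{e\<in>Old. b \<in> e} = {{a, b, c}}"
  "{e\<in>Old. c \<in> e} = {{a, b, c}}" "{e\<in>Old. a' \<in> e} = {{a', b', c'}}"
  "{e\<in>Old. b' \<in> e} = {{a', b', c'}}" "{e\<in>Old. c' \<in> e} = {{a', b', c'}}"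
  "{e\<in>Old. a'' \<in> e} = {{a'', b'', c''}}" "{e\<in>Old. b'' \<in> e} = {{a'', b'', c''}}"
  "{e\<in>Old. c'' \<in> e} = {{a'', b'', c''}}"
  unfolding Old_def Collect_insert_conj by (simp_all add: neqs)

text \<open>Condenses the tables \<open>New_at\<close> and \<open>Old_at\<close>: an old point is
  either untouched by the exchange or lies in one removed and one new block. Both degrees and
  linearity use only this.\<close>

lemma New_at_cases:
  assumes "p \<in> P"
  obtains "{e\<in>New. p \<in> e} = {}" "{e\<in>Old. p \<in> e} = {}"
  | f g where "{e\<in>New. p \<in> e} = {f}" "{e\<in>Old. p \<in> e} = {g}"
proof (cases "p \<in> {a, b, c, a', b', c', a'', b'', c''}")
  case False
  then have "{e\<in>New. p \<in> e} = {}" "{e\<in>Old. p \<in> e} = {}"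
    using assms fresh by (auto simp: New_def Old_def)
  then show ?thesis by (rule that(1))
next
  case True
  \<comment> \<open>After rewriting with the tables, each of the nine cases is a conjunction of
    goals of this form.\<close>
  moreover have "\<exists>f. {u} = {f}" for u :: "'a set" by blast
  ultimately have "(\<exists>f. {e\<in>New. p \<in> e} = {f}) \<and> (\<exists>f. {e\<in>Old. p \<in> e} = {f})"
    by (elim insertE emptyE) (simp_all only: New_at Old_at simp_thms)
  then show ?thesis using that(2) by blast
qed

lemma degree:
  assumes p: "p \<in> P'"
  shows "card {e\<in>B'. p \<in> e} = 3"
proof (cases "p \<in> P")
  case False
  then have "{e\<in>B'. p \<in> e} = {e\<in>New. p \<in> e}"
    using subP by (auto simp: B'_def)
  moreover have "card {e\<in>New. x \<in> e} = 3" "card {e\<in>New. y \<in> e} = 3" "card {e\<in>New. z \<in> e} = 3"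
    unfolding New_at_fresh using distinct_New by (simp_all add: card_insert_if)
  moreover have "p = x \<or> p = y \<or> p = z"
    using False p by (auto simp: P'_def)
  ultimately show ?thesis by metis
next
  case True
  have 1: "{e\<in>B'. p \<in> e} = {e\<in>B - Old. p \<in> e} \<union> {e\<in>New. p \<in> e}"
    by (auto simp: B'_def)
  have 2: "{e\<in>B. p \<in> e} = {e\<in>B - Old. p \<in> e} \<union> {e\<in>Old. p \<in> e}"
    using blocks by (auto simp: Old_def)
  have one: "card {u} = 1" for u :: "'a set" by simp
  have 3: "card {e\<in>New. p \<in> e} = card {e\<in>Old. p \<in> e}"
    by (rule New_at_cases[OF True]) (simp_all only: one)
  have "card {e\<in>B'. p \<in> e} = card {e\<in>B - Old. p \<in> e} + card {e\<in>New. p \<in> e}"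
    unfolding 1 by (rule card_Un_disjoint) (use fin New_disjoint in auto)
  also have "\<dots> = card {e\<in>B. p \<in> e}"
    unfolding 2 3 by (rule card_Un_disjoint[symmetric]) (use fin in auto)
  finally show ?thesis
    using config True by (simp add: sym_config_v3_def)
qed

text \<open>An old point lies in at most one new block, so two new blocks sharing one coincide. What
  remains are the three pairs of fresh points, each contained in a single new block.\<close>

lemma New_linear:
  assumes ef: "e \<in> New" "f \<in> New" "p \<noteq> q" "p \<in> e" "q \<in> e" "p \<in> f" "q \<in> f"
  shows "e = f"
proof -
  have old: "e = f" if "r \<in> P" "r \<in> e" "r \<in> f" for r
  proof -
    have "e \<in> {e\<in>New. r \<in> e}" "f \<in> {e\<in>New. r \<in> e}" using ef(1,2) that by simp_all
    then show ?thesis by (metis (no_types, lifting) New_at_cases[OF that(1)] empty_iff singletonD)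
  qed
  have "p \<in> P' \<and> q \<in> P'"
    using ef(1,4,5) New_subset by blast
  then consider "p \<in> P \<or> q \<in> P" | "{p, q} = {x, y}" | "{p, q} = {x, z}" | "{p, q} = {y, z}"
    using \<open>p \<noteq> q\<close> unfolding P'_def by blast
  then show ?thesis
  proof cases
    case 1
    then show ?thesis using old ef by blast
  next
    case 2
    then have "x \<in> e \<and> y \<in> e \<and> x \<in> f \<and> y \<in> f" using ef(4-7) by (auto simp: doubleton_eq_iff)
    then have "e \<in> {e\<in>New. x \<in> e \<and> y \<in> e}" "f \<in> {e\<in>New. x \<in> e \<and> y \<in> e}" using ef(1,2) by simp_all
    then show ?thesis unfolding New_at_fresh_pair by simp
  next
    case 3
    then have "x \<in> e \<and> z \<in> e \<and> x \<in> f \<and> z \<in> f" using ef(4-7) by (auto simp: doubleton_eq_iff)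
    then have "e \<in> {e\<in>New. x \<in> e \<and> z \<in> e}" "f \<in> {e\<in>New. x \<in> e \<and> z \<in> e}" using ef(1,2) by simp_all
    then show ?thesis unfolding New_at_fresh_pair by simp
  next
    case 4
    then have "y \<in> e \<and> z \<in> e \<and> y \<in> f \<and> z \<in> f" using ef(4-7) by (auto simp: doubleton_eq_iff)
    then have "e \<in> {e\<in>New. y \<in> e \<and> z \<in> e}" "f \<in> {e\<in>New. y \<in> e \<and> z \<in> e}" using ef(1,2) by simp_all
    then show ?thesis unfolding New_at_fresh_pair by simp
  qed
qed

text \<open>The reason why the exchange creates no conflict with the blocks that stay: two old
  points joined by a new block were already joined by a removed one.\<close>

lemma New_pair_in_Old:
  assumes "e \<in> New" "p \<in> P" "q \<in> P" "p \<noteq> q" "p \<in> e" "q \<in> e"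
  shows "\<exists>f\<in>Old. p \<in> f \<and> q \<in> f"
proof -
  have "x \<noteq> p" "y \<noteq> p" "z \<noteq> p" "x \<noteq> q" "y \<noteq> q" "z \<noteq> q" using assms(2,3) fresh by auto
  then show ?thesis using assms(1,4-6) unfolding New_def Old_def by auto
qed

lemma linear:
  assumes "p \<noteq> q" "e \<in> B'" "f \<in> B'" "p \<in> e" "q \<in> e" "p \<in> f" "q \<in> f"
  shows "e = f"
proof -
  have lin: "e = f" if "e \<in> B" "f \<in> B" "p \<in> e" "q \<in> e" "p \<in> f" "q \<in> f" for e f
  proof -
    have "p \<in> P" "q \<in> P" using that subP by blast+
    then have "card {b\<in>B. p \<in> b \<and> q \<in> b} \<le> Suc 0"
      using config \<open>p \<noteq> q\<close> by (simp add: sym_config_v3_def)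
    then show ?thesis using that fin by (simp add: card_common_blocks_le_1_iff)
  qed
  \<comment> \<open>Two points common to a kept and a new block are old, hence also lie in a removed
    block; linearity of \<open>B\<close> would identify it with the kept one.\<close>
  have mixed: False if ef: "e \<in> B - Old" "f \<in> New" "p \<in> e" "q \<in> e" "p \<in> f" "q \<in> f" for e f
  proof -
    obtain g where "g \<in> Old" "p \<in> g" "q \<in> g"
      using ef subP[of e] \<open>p \<noteq> q\<close> New_pair_in_Old[of f p q] by blast
    moreover have "Old \<subseteq> B" using blocks by (auto simp: Old_def)
    ultimately show False using lin[of e g] ef by blast
  qed
  show ?thesis
    using assms lin[of e f] mixed[of e f] mixed[of f e] New_linear[of e f p q]
    unfolding B'_def by blast
qed

lemma sym_config: "sym_config_v3 P' B' (v + 3)"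
proof -
  have "card P' = v + 3"
    using fin fresh config by (simp add: P'_def sym_config_v3_def)
  moreover have "e \<subseteq> P' \<and> card e = 3" if "e \<in> B'" for e
  proof (cases "e \<in> New")
    case True
    moreover have "\<forall>e\<in>New. card e = 3" by (simp add: New_def neqs)
    ultimately show ?thesis using New_subset by blast
  next
    case False
    then show ?thesis using that config by (auto simp: B'_def P'_def sym_config_v3_def)
  qed
  moreover have "finite P'" "finite B'" using fin by (auto simp: P'_def B'_def)
  ultimately show ?thesis
    unfolding sym_config_v3_def One_nat_def
    using card_blocks degree linear by (simp add: card_common_blocks_le_1_iff)
qed

text \<open>Let \<open>X\<close> be the side containing \<open>x\<close>. The three new blocks
  through \<open>x\<close> bring \<open>y\<close> and \<open>z\<close> into \<open>X\<close>, and
  these bring in the other new blocks. So all removed blocks lie in \<open>X\<close>, and deleting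
  \<open>x\<close>, \<open>y\<close>, \<open>z\<close> from \<open>X\<close> splits the original
  configuration.\<close>

lemma connected:
  assumes "config_connected P B"
  shows "config_connected P' B'"
  unfolding config_connected_def
proof (intro notI, elim exE conjE)
  fix P1 P2
  assume P12: "P1 \<noteq> {}" "P2 \<noteq> {}" "P1 \<inter> P2 = {}" "P1 \<union> P2 = P'"
    and split: "\<forall>e\<in>B'. e \<subseteq> P1 \<or> e \<subseteq> P2"
  have False if P: "X \<noteq> {}" "Y \<noteq> {}" "X \<inter> Y = {}" "X \<union> Y = P'"
    and s: "\<forall>e\<in>B'. e \<subseteq> X \<or> e \<subseteq> Y" and x: "x \<in> X" for X Y
  proof -
    have new: "e \<subseteq> X \<or> e \<subseteq> Y" if "e \<in> New" for e using s that by (auto simp: B'_def)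
    have X: "e \<subseteq> X" if "e \<in> New" "e \<inter> X \<noteq> {}" for e using new[OF that(1)] that(2) P(3) by blast
    have 1: "{x, y, c''} \<subseteq> X" "{x, z, c'} \<subseteq> X" "{x, b, c} \<subseteq> X"
      using x by (intro X; simp add: New_def)+
    then have 2: "{a, y, z} \<subseteq> X" "{a', y, b'} \<subseteq> X" "{a'', z, b''} \<subseteq> X"
      by (intro X; simp add: New_def)+
    have "e \<subseteq> X - {x, y, z} \<or> e \<subseteq> Y" if e: "e \<in> B" for e
    proof (cases "e \<in> Old")
      case True
      then have "e \<subseteq> X" using 1 2 unfolding Old_def by auto
      then show ?thesis using subP[OF e] fresh by blast
    next
      case False
      then show ?thesis using s e subP[OF e] fresh unfolding B'_def by blast
    qed
    moreover have "X - {x, y, z} \<noteq> {}" using 2 neqs by blast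
    moreover have "(X - {x, y, z}) \<inter> Y = {}" using P by blast
    moreover have "(X - {x, y, z}) \<union> Y = P" using P 1 2 fresh unfolding P'_def by blast
    ultimately have "\<exists>P1 P2. P1 \<noteq> {} \<and> P2 \<noteq> {} \<and> P1 \<inter> P2 = {} \<and> P1 \<union> P2 = P \<and>
        (\<forall>b\<in>B. b \<subseteq> P1 \<or> b \<subseteq> P2)"
      using P(2) by (intro exI[of _ "X - {x, y, z}"] exI[of _ Y]) simp
    then show False using assms unfolding config_connected_def by contradiction
  qed
  note F = this
  have "x \<in> P1 \<or> x \<in> P2" using P12 by (auto simp: P'_def)
  then show False
    using F[of P1 P2] F[of P2 P1] P12 split by blast
qed

text \<open>With \<open>x\<close> coloured in and \<open>y\<close>, \<open>z\<close> left out, the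
  new blocks without \<open>x\<close> are met in \<open>a\<close>, \<open>a'\<close>,
  \<open>a''\<close>, and each new block retains a point outside. Kept blocks do not contain
  \<open>x\<close>.\<close>

lemma blocking:
  assumes Q: "blocking_set P B Q" and "a \<in> Q" "a' \<in> Q" "a'' \<in> Q" "c \<notin> Q" "c' \<notin> Q" "c'' \<notin> Q"
  shows "blocking_set P' B' (insert x Q)" "card (insert x Q) = card Q + 1"
proof -
  have QP: "Q \<subseteq> P" using Q by (simp add: blocking_set_def)
  then have "x \<notin> Q" "y \<notin> Q" "z \<notin> Q" using fresh by auto
  moreover have "finite Q" using QP fin finite_subset by blast
  ultimately show "card (insert x Q) = card Q + 1" by simp
  have New: "\<forall>e\<in>New. e \<inter> insert x Q \<noteq> {} \<and> e - insert x Q \<noteq> {}"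
    using assms(2-7) \<open>x \<notin> Q\<close> \<open>y \<notin> Q\<close> \<open>z \<notin> Q\<close>
    by (simp add: New_def neqs insert_Diff_if Int_insert_left)
  have "e \<inter> insert x Q \<noteq> {} \<and> e - insert x Q \<noteq> {}" if "e \<in> B'" for e
  proof (cases "e \<in> New")
    case True
    then show ?thesis using New by blast
  next
    case False
    then have "e \<in> B" using that by (simp add: B'_def)
    then have "e \<inter> Q \<noteq> {} \<and> e - Q \<noteq> {}" "x \<notin> e"
      using Q subP fresh by (auto simp: blocking_set_def)
    then show ?thesis by blast
  qed
  then show "blocking_set P' B' (insert x Q)"
    using QP by (auto simp: blocking_set_def P'_def)
qed

text \<open>These three blocks serve for the next exchange.\<close>

lemma disjoint_New:
  "{a', y, b'} \<inter> {a'', z, b''} = {}" "{a', y, b'} \<inter> {x, b, c} = {}" "{a'', z, b''} \<inter> {x, b, c} = {}"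
  by (auto simp: neqs)

end

section \<open>Iterating the exchange\<close>

definition extendable :: "'a set \<Rightarrow> 'a set set \<Rightarrow> nat \<Rightarrow> nat \<Rightarrow> nat \<Rightarrow> bool" where
  "extendable P B v k m \<longleftrightarrow> sym_config_v3 P B v \<and> config_connected P B \<and>
     (\<exists>Q. blocking_set P B Q \<and> card Q = m) \<and>
     (\<exists>L\<subseteq>B. forces_heavy L k \<and> (\<exists>A\<in>B - L. \<exists>A'\<in>B - L. \<exists>A''\<in>B - L.
        A \<inter> A' = {} \<and> A \<inter> A'' = {} \<and> A' \<inter> A'' = {}))"

text \<open>Infinitely many points guarantee three fresh ones. The same \<open>L\<close> witnesses
  the result, because the exchange removes only blocks outside \<open>L\<close> and adds only blocks
  outside \<open>B\<close>.\<close>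

lemma extendable_step:
  fixes P :: "'a set"
  assumes "extendable P B v k m" and inf: "infinite (UNIV :: 'a set)"
  shows "\<exists>(P' :: 'a set) B'. extendable P' B' (v + 3) k (m + 1)"
proof -
  obtain Q L A A' A'' where C: "sym_config_v3 P B v" "config_connected P B"
    and Q: "blocking_set P B Q" "card Q = m" and L: "L \<subseteq> B" "forces_heavy L k"
    and A: "A \<in> B" "A' \<in> B" "A'' \<in> B" "A \<notin> L" "A' \<notin> L" "A'' \<notin> L"
    and disj: "A \<inter> A' = {}" "A \<inter> A'' = {}" "A' \<inter> A'' = {}"
    using assms(1) unfolding extendable_def by blast
  have bi: "card e = 3" "bichromatic Q e" if "e \<in> B" for e
    using that C Q by (auto simp: sym_config_v3_def blocking_set_def bichromatic_def)
  obtain a b c where a: "A = {a, b, c}" "distinct [a, b, c]" "a \<in> Q" "c \<notin> Q"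
    using bichromatic_triple[OF bi] A(1) by metis
  obtain a' b' c' where a': "A' = {a', b', c'}" "distinct [a', b', c']" "a' \<in> Q" "c' \<notin> Q"
    using bichromatic_triple[OF bi] A(2) by metis
  obtain a'' b'' c'' where a'': "A'' = {a'', b'', c''}" "distinct [a'', b'', c'']" "a'' \<in> Q" "c'' \<notin> Q"
    using bichromatic_triple[OF bi] A(3) by metis
  have fin: "finite P" using C by (simp add: sym_config_v3_def)
  obtain x where x: "x \<notin> P" using ex_new_if_finite[OF inf fin] by blast
  obtain y where y: "y \<notin> insert x P" using ex_new_if_finite[OF inf, of "insert x P"] fin by blast
  obtain z where z: "z \<notin> insert y (insert x P)"
    using ex_new_if_finite[OF inf, of "insert y (insert x P)"] fin by blast
  interpret three_disjoint_blocks P B v x y z a b c a' b' c' a'' b'' c''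
    by unfold_locales (use C A a a' a'' disj x y z in auto)
  have "L \<subseteq> B'" using L A a a' a'' by (auto simp: B'_def Old_def)
  moreover have "\<exists>A\<in>B' - L. \<exists>A'\<in>B' - L. \<exists>A''\<in>B' - L.
      A \<inter> A' = {} \<and> A \<inter> A'' = {} \<and> A' \<inter> A'' = {}"
  proof -
    have "e \<in> B' - L" if "e \<in> New" for e
      using that New_disjoint L(1) by (auto simp: B'_def)
    then have "{a', y, b'} \<in> B' - L" "{a'', z, b''} \<in> B' - L" "{x, b, c} \<in> B' - L"
      by (simp_all add: New_def)
    with disjoint_New show ?thesis
      by (intro bexI[of _ "{a', y, b'}"] bexI[of _ "{a'', z, b''}"] bexI[of _ "{x, b, c}"] conjI)
  qed
  moreover have "blocking_set P' B' (insert x Q)" "card (insert x Q) = m + 1"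
    using blocking[OF Q(1)] a a' a'' Q(2) by auto
  ultimately have "extendable P' B' (v + 3) k (m + 1)"
    unfolding extendable_def using sym_config connected[OF C(2)] L(2) by metis
  then show ?thesis by blast
qed

definition attains_min_blocking :: "nat \<Rightarrow> nat \<Rightarrow> bool" where
  "attains_min_blocking v m \<longleftrightarrow> (\<exists>(P :: nat set) B. sym_config_v3 P B v \<and> config_connected P B \<and>
     min_blocking_card P B m)"

lemma extendable_iterate:
  fixes P :: "nat set"
  assumes "extendable P B v k m"
  shows "\<exists>(P' :: nat set) B'. extendable P' B' (v + 3 * n) k (m + n)"
proof (induction n)
  case 0
  then show ?case using assms by auto
next
  case (Suc n)
  then show ?case using extendable_step by (fastforce simp: algebra_simps)
qed

text \<open>The inequality \<open>3 * m < v + k + 3\<close> is invariant when \<open>v\<close> grows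
  by 3 and \<open>m\<close> by 1, so it need be checked only at the start.\<close>

lemma extendable_attains_min_blocking:
  fixes P :: "nat set"
  assumes "extendable P B v k m" "3 * m < v + k + 3"
  shows "attains_min_blocking (v + 3 * n) (m + n)"
proof -
  obtain P' :: "nat set" and B' where E: "extendable P' B' (v + 3 * n) k (m + n)"
    using extendable_iterate[OF assms(1)] by blast
  then obtain Q L where "sym_config_v3 P' B' (v + 3 * n)" "config_connected P' B'"
    "blocking_set P' B' Q" "card Q = m + n" "L \<subseteq> B'" "forces_heavy L k"
    unfolding extendable_def by blast
  moreover have "3 * (m + n) < v + 3 * n + k + 3" using assms(2) by simp
  ultimately show ?thesis
    unfolding attains_min_blocking_def using min_blocking_card_if_forces_heavy by metis
qed

section \<open>Configurations given by lists\<close>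

type_synonym triple = "nat \<times> nat \<times> nat"

fun block_of :: "triple \<Rightarrow> nat set" where
  "block_of (a, b, c) = {a, b, c}"

fun increasing :: "nat \<Rightarrow> triple \<Rightarrow> bool" where
  "increasing v (a, b, c) \<longleftrightarrow> a < b \<and> b < c \<and> c < v"

fun occurs :: "nat \<Rightarrow> triple \<Rightarrow> bool" where
  "occurs p (a, b, c) \<longleftrightarrow> p = a \<or> p = b \<or> p = c"

fun pairs_of :: "triple \<Rightarrow> (nat \<times> nat) list" where
  "pairs_of (a, b, c) = [(a, b), (a, c), (b, c)]"

text \<open>Distinctness of all pairs encodes linearity. The last clause, joining every nonzero
  point to a smaller one, is a certificate of connectedness.\<close>

definition config_list :: "nat \<Rightarrow> triple list \<Rightarrow> bool" where
  "config_list v ts \<longleftrightarrow> length ts = v \<and> list_all (increasing v) ts \<and>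
     distinct (concat (map pairs_of ts)) \<and>
     list_all (\<lambda>p. length (filter (occurs p) ts) = 3) [0..<v] \<and>
     list_all (\<lambda>p. list_ex (\<lambda>(a, b, c). p = b \<or> p = c) ts) [1..<v]"

fun splits_triple :: "(nat \<Rightarrow> bool) \<Rightarrow> triple \<Rightarrow> bool" where
  "splits_triple q (a, b, c) \<longleftrightarrow> (q a \<or> q b \<or> q c) \<and> \<not> (q a \<and> q b \<and> q c)"

fun heavy_triple :: "(nat \<Rightarrow> bool) \<Rightarrow> triple \<Rightarrow> bool" where
  "heavy_triple q (a, b, c) \<longleftrightarrow> (q a \<and> q b) \<or> (q a \<and> q c) \<or> (q b \<and> q c)"

lemma mem_block_of: "p \<in> block_of t \<longleftrightarrow> occurs p t"
  by (cases t) auto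

lemma inj_on_block_of: "inj_on block_of {t. increasing v t}"
proof (rule inj_onI)
  fix s t assume st: "s \<in> {t. increasing v t}" "t \<in> {t. increasing v t}" and eq: "block_of s = block_of t"
  obtain a b c a' b' c' where [simp]: "s = (a, b, c)" "t = (a', b', c')" by (cases s, cases t)
  have lt: "a < b" "b < c" "a' < b'" "b' < c'" using st by auto
  have "x \<in> block_of s \<longleftrightarrow> x \<in> block_of t" for x using eq by simp
  from this[of a] this[of b] this[of c] this[of a'] this[of b'] this[of c']
  show "s = t" using lt by auto
qed

lemma bichromatic_block_of:
  "bichromatic Q (block_of t) \<longleftrightarrow> splits_triple (\<lambda>p. p \<in> Q) t"
  by (cases t) (auto simp: bichromatic_def)

lemma heavy_block_of:
  assumes "increasing v t"
  shows "2 \<le> card (block_of t \<inter> Q) \<longleftrightarrow> heavy_triple (\<lambda>p. p \<in> Q) t"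
  using assms by (cases t) (auto simp: Int_insert_left card_insert_if)

text \<open>Every triple contributes a nonempty list of pairs, so a repeated triple, or two triples
  sharing a pair, would produce a repetition in the concatenation.\<close>

lemma distinct_pairs_of:
  assumes "distinct (concat (map pairs_of ts))"
  shows "distinct ts \<and>
    (\<forall>s\<in>set ts. \<forall>t\<in>set ts. set (pairs_of s) \<inter> set (pairs_of t) \<noteq> {} \<longrightarrow> s = t)"
  using assms
proof (induction ts)
  case (Cons u ts)
  have disj: "set (pairs_of u) \<inter> set (pairs_of t) = {}" if "t \<in> set ts" for t
    using Cons.prems that by auto
  have "set (pairs_of u) \<noteq> {}" by (cases u) auto
  then have "u \<notin> set ts" using disj[of u] by auto
  moreover have "distinct (concat (map pairs_of ts))" using Cons.prems by simp
  moreover have "set (pairs_of t) \<inter> set (pairs_of u) = {}" if "t \<in> set ts" for t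
    using disj[OF that] by (simp add: Int_commute)
  ultimately show ?case using Cons.IH disj by simp
qed simp

lemma mem_pairs_of:
  assumes "increasing v t" "occurs p t" "occurs q t" "p < q"
  shows "(p, q) \<in> set (pairs_of t)"
  using assms by (cases t) auto

lemma config_list_sym_config:
  assumes C: "config_list v ts"
  shows "sym_config_v3 {..<v} (block_of ` set ts) v"
proof -
  have inc: "increasing v t" if "t \<in> set ts" for t
    using C that by (auto simp: config_list_def list_all_iff)
  then have inj: "inj_on block_of (set ts)"
    using inj_on_block_of[of v] by (auto intro: inj_on_subset)
  have pairs: "distinct (concat (map pairs_of ts))" and len: "length ts = v"
    using C by (auto simp: config_list_def)
  note dist = distinct_pairs_of[OF pairs, THEN conjunct1]
  have "card (block_of ` set ts) = v"
    using inj dist len by (simp add: card_image distinct_card)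
  moreover have "block_of t \<subseteq> {..<v} \<and> card (block_of t) = 3" if "t \<in> set ts" for t
    using inc[OF that] by (cases t) auto
  moreover have "card {b \<in> block_of ` set ts. p \<in> b} = 3" if "p < v" for p
  proof -
    have "{b \<in> block_of ` set ts. p \<in> b} = block_of ` set (filter (occurs p) ts)"
      by (auto simp: mem_block_of)
    moreover have "inj_on block_of (set (filter (occurs p) ts))"
      using inj by (rule inj_on_subset) auto
    moreover have "length (filter (occurs p) ts) = 3"
      using C that by (auto simp: config_list_def list_all_iff)
    ultimately show ?thesis
      using dist by (simp add: card_image distinct_card del: set_filter)
  qed
  moreover have lin: "s = t" if "s \<in> set ts" "t \<in> set ts" "p < q"
      "occurs p s" "occurs q s" "occurs p t" "occurs q t" for p q s t
    using distinct_pairs_of[OF pairs] mem_pairs_of[OF inc] that by blast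
  have lin': "s = t" if "s \<in> set ts" "t \<in> set ts" "p \<noteq> q"
      "occurs p s" "occurs q s" "occurs p t" "occurs q t" for p q s t
    using lin[of s t p q] lin[of s t q p] that by (cases p q rule: linorder_cases) auto
  have "card {b \<in> block_of ` set ts. p \<in> b \<and> q \<in> b} \<le> Suc 0" if "p \<noteq> q" for p q
    unfolding card_common_blocks_le_1_iff[OF finite_imageI[OF finite_set]]
    by (intro ballI impI, elim imageE, hypsubst, unfold mem_block_of)
      (rule arg_cong[of _ _ block_of], rule lin'[OF _ _ that])
  ultimately show ?thesis
    by (simp add: sym_config_v3_def)
qed

text \<open>Strong induction: every nonzero point shares a block with a smaller point, hence lies on
  the same side of a splitting as 0.\<close>

lemma config_list_connected:
  assumes C: "config_list v ts"
  shows "config_connected {..<v} (block_of ` set ts)"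
  unfolding config_connected_def
proof (intro notI, elim exE conjE)
  fix P1 P2
  assume P: "P1 \<noteq> {}" "P2 \<noteq> {}" "P1 \<inter> P2 = {}" "P1 \<union> P2 = {..<v}"
    and split: "\<forall>b\<in>block_of ` set ts. b \<subseteq> P1 \<or> b \<subseteq> P2"
  have main: "{..<v} \<subseteq> X" if X: "0 \<in> X" "X \<inter> Y = {}" "X \<union> Y = {..<v}"
    "\<forall>b\<in>block_of ` set ts. b \<subseteq> X \<or> b \<subseteq> Y" for X Y
  proof -
    have "p < v \<longrightarrow> p \<in> X" for p
    proof (induction p rule: less_induct)
      case (less p)
      show ?case
      proof (cases "p = 0")
        case False
        show ?thesis
        proof
          assume "p < v"
          with False C have "list_ex (\<lambda>(a, b, c). p = b \<or> p = c) ts"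
            by (auto simp: config_list_def list_all_iff)
          then obtain a b c where t: "(a, b, c) \<in> set ts" "p = b \<or> p = c"
            by (auto simp: list_ex_iff)
          moreover have "increasing v (a, b, c)"
            using C t by (auto simp: config_list_def list_all_iff)
          ultimately have "a < p" "a < v" by auto
          then have "a \<in> X" using less by simp
          moreover have "{a, b, c} \<subseteq> X \<or> {a, b, c} \<subseteq> Y"
            using X(4) t(1) by force
          ultimately show "p \<in> X" using X(2) t(2) by blast
        qed
      qed (use X in simp)
    qed
    then show ?thesis by blast
  qed
  have "0 \<in> P1 \<or> 0 \<in> P2"
  proof -
    have "v \<noteq> 0" using P by auto
    then show ?thesis using P(4) by auto
  qed
  then show False
    using main[of P1 P2] main[of P2 P1] P split by blast
qed

section \<open>Verified search for forced heavy blocks\<close>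

text \<open>Exhaustive search over the colourings of the points \<open>0, 1, 2, \<dots>\<close> in this order. The colours
  assigned so far are kept most recent first; \<open>k\<close> is the number of heavy blocks still needed.
  The constraints of the next point \<open>p\<close> are its triples \<open>(a, b, p)\<close>, stored as the positions
  of \<open>a\<close> and \<open>b\<close> in the list of colours.\<close>

fun spend :: "bool \<Rightarrow> bool list \<Rightarrow> (nat \<times> nat) list \<Rightarrow> nat \<Rightarrow> nat" where
  "spend x h [] k = k"
| "spend x h ((i, j) # cs) k = (let y = h ! i; z = h ! j in
     if x \<and> y \<and> z \<or> \<not> (x \<or> y \<or> z) then 0
     else spend x h cs (if x \<and> y \<or> x \<and> z \<or> y \<and> z then k - 1 else k))"

text \<open>The demand 0 closes a branch for either of two reasons: enough heavy blocks were found,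
  or \<open>spend\<close> met a monochromatic triple, so that no admissible colouring extends the
  branch.\<close>

fun exhausts :: "(nat \<times> nat) list list \<Rightarrow> bool list \<Rightarrow> nat \<Rightarrow> bool" where
  "exhausts css h 0 \<longleftrightarrow> True"
| "exhausts [] h (Suc k) \<longleftrightarrow> False"
| "exhausts (cs # css) h (Suc k) \<longleftrightarrow>
     exhausts css (True # h) (spend True h cs (Suc k)) \<and>
     exhausts css (False # h) (spend False h cs (Suc k))"

text \<open>A triple is examined when its largest point \<open>p\<close> is coloured. The
  \<open>p\<close> earlier colours are then stored newest first, which puts that of \<open>a\<close>
  at position \<open>p - 1 - a\<close>.\<close>

definition constraints :: "triple list \<Rightarrow> nat \<Rightarrow> (nat \<times> nat) list" where
  "constraints ts p = map (\<lambda>(a, b, c). (p - 1 - a, p - 1 - b)) (filter (\<lambda>(a, b, c). c = p) ts)"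

text \<open>As \<open>q\<close> splits all the triples, the exit for monochromatic ones is never
  taken, and the demand drops by at most one for each heavy triple.\<close>

lemma spend_sound:
  fixes q :: "nat \<Rightarrow> bool"
  assumes "list_all (\<lambda>(a, b, c). a < p \<and> b < p \<and> c = p) ts"
    and "list_all (splits_triple q) ts"
  shows "k \<le> spend (q p) (map q (rev [0..<p])) (map (\<lambda>(a, b, c). (p - 1 - a, p - 1 - b)) ts) k +
    length (filter (heavy_triple q) ts)"
  using assms
proof (induction ts arbitrary: k)
  case (Cons t ts)
  obtain a b c where t: "t = (a, b, c)" by (cases t)
  have nth: "map q (rev [0..<p]) ! (p - 1 - i) = q i" if "i < p" for i
    using that by (simp add: rev_nth)
  let ?sp = "spend (q p) (map q (rev [0..<p])) (map (\<lambda>(a, b, c). (p - 1 - a, p - 1 - b)) ts)"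
  have IH: "k \<le> ?sp k + length (filter (heavy_triple q) ts)" for k
    using Cons by simp
  have "k \<le> Suc (?sp (k - 1) + length (filter (heavy_triple q) ts))"
    using IH[of "k - 1"] by linarith
  moreover have "a < p" "b < p" "c = p" "splits_triple q (a, b, p)"
    using Cons.prems by (auto simp: t)
  ultimately show ?case
    using IH[of k] by (simp only: t list.map prod.case spend.simps Let_def nth) auto
qed simp

text \<open>Follows the branch prescribed by \<open>q\<close>, by induction on the number of
  uncoloured points. Heavy triples are counted at their largest point; once all points are coloured,
  success of the search means \<open>k = 0\<close>.\<close>

lemma exhausts_sound:
  assumes inc: "list_all (increasing v) ts" and split: "list_all (splits_triple q) ts"
    and "exhausts (map (constraints ts) [p..<v]) (map q (rev [0..<p])) k" "p \<le> v"
  shows "k \<le> length (filter (\<lambda>t. p \<le> snd (snd t) \<and> heavy_triple q t) ts)"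
  using assms(3,4)
proof (induction "v - p" arbitrary: p k)
  case 0
  then show ?case by (cases k) auto
next
  case (Suc n)
  show ?case
  proof (cases k)
    case (Suc k')
    let ?h = "map q (rev [0..<p])"
    have pv: "p < v" using Suc.hyps(2) by simp
    then have up: "[p..<v] = p # [Suc p..<v]" by (simp add: upt_conv_Cons)
    define ts' where "ts' = filter (\<lambda>(a, b, c). c = p) ts"
    have "exhausts (map (constraints ts) [Suc p..<v]) (q p # ?h) (spend (q p) ?h (constraints ts p) k)"
      using Suc.prems(1) unfolding up Suc by (cases "q p") simp_all
    then have "exhausts (map (constraints ts) [Suc p..<v]) (map q (rev [0..<Suc p]))
        (spend (q p) ?h (constraints ts p) k)" by simp
    then have "spend (q p) ?h (constraints ts p) k
        \<le> length (filter (\<lambda>t. Suc p \<le> snd (snd t) \<and> heavy_triple q t) ts)"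
      using Suc.hyps(1)[of "Suc p"] Suc.hyps(2) pv by simp
    moreover have "k \<le> spend (q p) ?h (constraints ts p) k + length (filter (heavy_triple q) ts')"
      unfolding constraints_def ts'_def
      by (rule spend_sound) (use inc split in \<open>auto simp: list_all_iff\<close>)
    moreover have "length (filter (heavy_triple q) ts') +
        length (filter (\<lambda>t. Suc p \<le> snd (snd t) \<and> heavy_triple q t) ts) =
        length (filter (\<lambda>t. p \<le> snd (snd t) \<and> heavy_triple q t) ts)"
      unfolding ts'_def by (induction ts) auto
    ultimately show ?thesis by linarith
  qed simp
qed

text \<open>Membership in \<open>Q\<close> is a colouring covered by the search, and from
  \<open>p = 0\<close> on every heavy triple is counted. Injectivity of \<open>block_of\<close>
  turns the count of triples into one of blocks.\<close>

lemma exhausts_forces_heavy: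
  assumes inc: "list_all (increasing v) ts" and dist: "distinct ts"
    and ex: "exhausts (map (constraints ts) [0..<v]) [] k"
  shows "forces_heavy (block_of ` set ts) k"
  unfolding forces_heavy_def
proof (intro allI impI)
  fix Q assume "\<forall>b\<in>block_of ` set ts. bichromatic Q b"
  then have "list_all (splits_triple (\<lambda>p. p \<in> Q)) ts"
    by (auto simp: list_all_iff bichromatic_block_of)
  then have "k \<le> length (filter (heavy_triple (\<lambda>p. p \<in> Q)) ts)"
    using exhausts_sound[OF inc, of "\<lambda>p. p \<in> Q" 0 k] ex by simp
  also have "\<dots> = card (set (filter (heavy_triple (\<lambda>p. p \<in> Q)) ts))"
    using dist by (simp add: distinct_card del: set_filter)
  also have "\<dots> = card (block_of ` set (filter (heavy_triple (\<lambda>p. p \<in> Q)) ts))"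
  proof -
    have "inj_on block_of (set (filter (heavy_triple (\<lambda>p. p \<in> Q)) ts))"
      using inj_on_block_of[of v] inc by (rule_tac inj_on_subset) (auto simp: list_all_iff)
    then show ?thesis by (simp add: card_image)
  qed
  also have "block_of ` set (filter (heavy_triple (\<lambda>p. p \<in> Q)) ts) = heavy_blocks (block_of ` set ts) Q"
  proof -
    have "set (filter (heavy_triple (\<lambda>p. p \<in> Q)) ts) = {t \<in> set ts. 2 \<le> card (block_of t \<inter> Q)}"
    proof -
      have "2 \<le> card (block_of t \<inter> Q) \<longleftrightarrow> heavy_triple (\<lambda>p. p \<in> Q) t" if "t \<in> set ts" for t
        using inc that heavy_block_of[of v t Q] by (simp add: list_all_iff)
      then show ?thesis unfolding set_filter by blast
    qed
    then show ?thesis by (auto simp: heavy_blocks_def)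
  qed
  finally show "k \<le> card (heavy_blocks (block_of ` set ts) Q)" .
qed

section \<open>From checked lists to attained values\<close>

definition blocking_list :: "nat \<Rightarrow> triple list \<Rightarrow> nat list \<Rightarrow> bool" where
  "blocking_list v ts qs \<longleftrightarrow> distinct qs \<and> list_all (\<lambda>p. p < v) qs \<and>
     list_all (splits_triple (\<lambda>p. p \<in> set qs)) ts"

lemma blocking_list_blocking_set:
  assumes "blocking_list v ts qs"
  shows "blocking_set {..<v} (block_of ` set ts) (set qs)" "card (set qs) = length qs"
  using assms bichromatic_block_of[of "set qs"]
  by (auto simp: blocking_list_def list_all_iff blocking_set_def distinct_card bichromatic_def)

text \<open>The list \<open>ts\<close> is the forcing family seen by the search; \<open>rs\<close>
  holds the remaining blocks. It is empty for isolated configurations and consists of three disjoint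
  blocks for those that start a family.\<close>

definition base_config :: "nat \<Rightarrow> nat \<Rightarrow> nat \<Rightarrow> triple list \<Rightarrow> triple list \<Rightarrow> nat list \<Rightarrow> bool" where
  "base_config v k m rs ts qs \<longleftrightarrow> config_list v (rs @ ts) \<and> blocking_list v (rs @ ts) qs \<and>
     length qs = m \<and> 3 * m < v + k + 3 \<and> exhausts (map (constraints ts) [0..<v]) [] k"

lemma base_config_forces_heavy:
  assumes "base_config v k m rs ts qs"
  shows "forces_heavy (block_of ` set ts) k"
proof (rule exhausts_forces_heavy)
  have C: "config_list v (rs @ ts)" using assms by (simp add: base_config_def)
  then show "list_all (increasing v) ts" by (simp add: config_list_def)
  have "distinct (rs @ ts)"
    using C distinct_pairs_of unfolding config_list_def by blast
  then show "distinct ts" by simp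
qed (use assms in \<open>simp add: base_config_def\<close>)

lemma base_config_attains_min_blocking:
  assumes "base_config v k m rs ts qs"
  shows "attains_min_blocking v m"
proof -
  have C: "config_list v (rs @ ts)" and Q: "blocking_list v (rs @ ts) qs"
    and k: "3 * m < v + k + 3" and m: "length qs = m"
    using assms by (auto simp: base_config_def)
  have "min_blocking_card {..<v} (block_of ` set (rs @ ts)) (card (set qs))"
    by (rule min_blocking_card_if_forces_heavy[OF config_list_sym_config[OF C] _
          base_config_forces_heavy[OF assms] blocking_list_blocking_set(1)[OF Q]])
      (use k m blocking_list_blocking_set(2)[OF Q] in auto)
  then show ?thesis
    using config_list_sym_config[OF C] config_list_connected[OF C] blocking_list_blocking_set(2)[OF Q] m
    unfolding attains_min_blocking_def by auto
qed

lemma base_config_extendable: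
  assumes B: "base_config v k m [r, r', r''] ts qs"
    and disj: "block_of r \<inter> block_of r' = {}" "block_of r \<inter> block_of r'' = {}"
      "block_of r' \<inter> block_of r'' = {}"
  shows "attains_min_blocking (v + 3 * n) (m + n)"
proof (rule extendable_attains_min_blocking)
  have C: "config_list v ([r, r', r''] @ ts)" and Q: "blocking_list v ([r, r', r''] @ ts) qs"
    and m: "length qs = m"
    using B by (simp_all add: base_config_def)
  have "distinct ([r, r', r''] @ ts)"
    using C distinct_pairs_of unfolding config_list_def by blast
  moreover have "inj_on block_of (set ([r, r', r''] @ ts))"
    using inj_on_block_of[of v] C by (rule_tac inj_on_subset) (auto simp: config_list_def list_all_iff)
  \<comment> \<open>The triples of \<open>rs\<close> differ from those of \<open>ts\<close>;
    injectivity of \<open>block_of\<close> carries this over to blocks.\<close>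
  ultimately have mem: "block_of s \<in> block_of ` set ([r, r', r''] @ ts) - block_of ` set ts"
    if "s \<in> {r, r', r''}" for s
    using that inj_on_image_mem_iff[of block_of "set ([r, r', r''] @ ts)" s "set ts"] by auto
  have "\<exists>A\<in>block_of ` set ([r, r', r''] @ ts) - block_of ` set ts.
      \<exists>A'\<in>block_of ` set ([r, r', r''] @ ts) - block_of ` set ts.
      \<exists>A''\<in>block_of ` set ([r, r', r''] @ ts) - block_of ` set ts.
        A \<inter> A' = {} \<and> A \<inter> A'' = {} \<and> A' \<inter> A'' = {}"
    by (intro bexI[of _ "block_of r"] bexI[of _ "block_of r'"] bexI[of _ "block_of r''"] conjI disj mem)
      simp_all
  moreover have "block_of ` set ts \<subseteq> block_of ` set ([r, r', r''] @ ts)" by auto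
  ultimately show "extendable {..<v} (block_of ` set ([r, r', r''] @ ts)) v k m"
    unfolding extendable_def
    using config_list_sym_config[OF C] config_list_connected[OF C] blocking_list_blocking_set[OF Q, unfolded m]
      base_config_forces_heavy[OF B]
    by (intro conjI exI[of _ "set qs"] exI[of _ "block_of ` set ts"])
  show "3 * m < v + k + 3" using B by (simp add: base_config_def)
qed

section \<open>Small and base configurations\<close>

text \<open>Here and in all configurations below, \<open>k = 3 * m - v - 2\<close>, the least demand
  compatible with \<open>3 * m < v + k + 3\<close>.\<close>

lemma config_8_4:
  "base_config 8 2 4
    []
    [(0, 1, 2), (0, 3, 7), (0, 4, 6), (1, 3, 4), (1, 5, 7), (2, 4, 5), (2, 6, 7), (3, 5, 6)]
    [1, 4, 6, 7]"
  by code_simp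

lemma config_9_4:
  "base_config 9 1 4
    []
    [(0, 1, 2), (0, 3, 5), (0, 4, 6), (1, 3, 4), (1, 6, 8), (2, 5, 8), (2, 6, 7), (3, 7, 8),
    (4, 5, 7)]
    [2, 3, 4, 6]"
  by code_simp

lemma config_10_5:
  "base_config 10 3 5
    []
    [(0, 1, 2), (0, 4, 8), (0, 6, 7), (1, 3, 5), (1, 7, 8), (2, 3, 4), (2, 5, 6), (3, 8, 9),
    (4, 6, 9), (5, 7, 9)]
    [2, 3, 6, 7, 8]"
  by code_simp

lemma config_11_5:
  "base_config 11 2 5
    []
    [(0, 1, 2), (0, 3, 5), (0, 6, 7), (1, 3, 4), (1, 9, 10), (2, 4, 5), (2, 6, 10), (3, 7,
    9), (4, 8, 10), (5, 7, 8), (6, 8, 9)]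
    [1, 5, 6, 7, 10]"
  by code_simp

lemma config_12_6:
  "base_config 12 4 6
    []
    [(0, 1, 2), (0, 5, 11), (0, 9, 10), (1, 3, 4), (1, 5, 10), (2, 3, 6), (2, 4, 5), (3, 7,
    8), (4, 6, 7), (6, 8, 9), (7, 9, 11), (8, 10, 11)]
    [0, 1, 5, 6, 7, 8]"
  by code_simp

lemma config_12_5:
  "base_config 12 1 5
    [(1, 6, 8), (3, 9, 11), (4, 5, 10)]
    [(0, 1, 2), (0, 3, 4), (0, 9, 10), (1, 3, 5), (2, 4, 6), (2, 8, 11), (5, 6, 7), (7, 8,
    9), (7, 10, 11)]
    [2, 3, 7, 8, 10]"
  by code_simp

lemma config_13_6:
  "base_config 13 3 6
    []
    [(0, 1, 2), (0, 3, 6), (0, 9, 10), (1, 3, 4), (1, 10, 11), (2, 3, 5), (2, 11, 12), (4,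
    5, 7), (4, 6, 8), (5, 9, 12), (6, 7, 9), (7, 8, 11), (8, 10, 12)]
    [1, 2, 5, 6, 7, 10]"
  by code_simp

lemma config_14_6:
  "base_config 14 2 6
    [(0, 8, 12), (2, 9, 10), (6, 7, 13)]
    [(0, 1, 2), (0, 4, 5), (1, 3, 4), (1, 5, 6), (2, 3, 6), (3, 5, 7), (4, 8, 9), (7, 10,
    11), (8, 11, 13), (9, 11, 12), (10, 12, 13)]
    [0, 3, 4, 6, 10, 11]"
  by code_simp

lemma config_15_7:
  "base_config 15 4 7
    []
    [(0, 1, 2), (0, 3, 7), (0, 4, 5), (1, 3, 6), (1, 7, 8), (2, 3, 4), (2, 5, 6), (4, 7, 9),
    (5, 12, 13), (6, 11, 13), (8, 9, 10), (8, 12, 14), (9, 11, 14), (10, 11, 12), (10, 13,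
    14)]
    [0, 2, 3, 8, 9, 11, 13]"
  by code_simp

lemma config_16_8:
  "base_config 16 6 8
    []
    [(0, 1, 2), (0, 6, 7), (0, 11, 13), (1, 3, 4), (1, 6, 11), (2, 3, 5), (2, 7, 10), (3, 8,
    9), (4, 6, 8), (4, 9, 15), (5, 7, 8), (5, 10, 12), (9, 13, 14), (10, 14, 15), (11, 12,
    14), (12, 13, 15)]
    [0, 2, 4, 5, 6, 9, 12, 14]"
  by code_simp

lemma config_16_7:
  "base_config 16 3 7
    [(6, 9, 14), (7, 11, 15), (8, 10, 13)]
    [(0, 1, 2), (0, 3, 4), (0, 5, 8), (1, 4, 5), (1, 7, 8), (2, 3, 7), (2, 4, 6), (3, 5, 6),
    (9, 10, 11), (9, 12, 13), (10, 12, 15), (11, 12, 14), (13, 14, 15)]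
    [2, 4, 5, 8, 9, 12, 15]"
  by code_simp

lemma config_17_8:
  "base_config 17 5 8
    []
    [(0, 1, 2), (0, 3, 6), (0, 5, 8), (1, 3, 5), (1, 8, 9), (2, 3, 4), (2, 6, 7), (4, 5, 6),
    (4, 7, 10), (7, 12, 16), (8, 14, 16), (9, 10, 11), (9, 13, 14), (10, 12, 15), (11, 12,
    13), (11, 14, 15), (13, 15, 16)]
    [2, 3, 5, 7, 8, 10, 11, 13]"
  by code_simp

lemma config_18_8:
  "base_config 18 4 8
    [(8, 12, 14), (9, 13, 17), (10, 11, 16)]
    [(0, 1, 2), (0, 3, 5), (0, 7, 9), (1, 3, 4), (1, 9, 10), (2, 3, 6), (2, 5, 7), (4, 5,
    6), (4, 8, 10), (6, 7, 8), (11, 12, 13), (11, 15, 17), (12, 15, 16), (13, 14, 15), (14,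
    16, 17)]
    [2, 3, 4, 7, 10, 12, 15, 17]"
  by code_simp

lemma config_19_9:
  "base_config 19 6 9
    []
    [(0, 1, 2), (0, 3, 4), (0, 5, 6), (1, 4, 5), (1, 16, 17), (2, 4, 7), (2, 5, 8), (3, 6,
    10), (3, 7, 9), (6, 8, 9), (7, 8, 10), (9, 10, 11), (11, 12, 13), (11, 14, 15), (12, 14,
    18), (12, 15, 17), (13, 14, 16), (13, 17, 18), (15, 16, 18)]
    [0, 1, 3, 7, 8, 11, 14, 17, 18]"
  by code_simp

lemma config_20_9:
  "base_config 20 5 9
    []
    [(0, 1, 2), (0, 3, 10), (0, 12, 13), (1, 3, 9), (1, 4, 5), (2, 3, 4), (2, 5, 6), (4, 6,
    7), (5, 7, 8), (6, 8, 11), (7, 16, 18), (8, 10, 12), (9, 11, 17), (9, 15, 16), (10, 13,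
    14), (11, 15, 19), (12, 14, 15), (13, 17, 18), (14, 18, 19), (16, 17, 19)]
    [0, 2, 4, 8, 9, 10, 15, 18, 19]"
  by code_simp

lemma config_22_10:
  "base_config 22 6 10
    []
    [(0, 1, 2), (0, 3, 4), (0, 5, 6), (1, 3, 5), (1, 6, 7), (2, 3, 6), (2, 4, 5), (4, 8,
    14), (7, 8, 9), (7, 11, 13), (8, 10, 12), (9, 10, 11), (9, 12, 13), (10, 19, 20), (11,
    17, 19), (12, 14, 15), (13, 15, 16), (14, 17, 18), (15, 18, 21), (16, 18, 20), (16, 19,
    21), (17, 20, 21)]
    [0, 3, 5, 7, 10, 13, 14, 18, 19, 21]"
  by code_simp

lemma config_23_10:
  "base_config 23 5 10
    [(8, 17, 21), (9, 16, 22), (15, 18, 20)]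
    [(0, 1, 2), (0, 3, 6), (0, 4, 5), (1, 3, 5), (1, 4, 6), (2, 3, 4), (2, 6, 7), (5, 8, 9),
    (7, 9, 10), (7, 12, 13), (8, 11, 14), (10, 11, 12), (10, 13, 14), (11, 13, 15), (12, 14,
    15), (16, 17, 18), (16, 19, 20), (17, 19, 22), (18, 19, 21), (20, 21, 22)]
    [0, 1, 4, 7, 8, 10, 15, 16, 21, 22]"
  by code_simp

lemma config_25_11:
  "base_config 25 6 11
    []
    [(0, 1, 2), (0, 3, 5), (0, 4, 6), (1, 3, 7), (1, 4, 5), (2, 3, 4), (2, 5, 6), (6, 8,
    10), (7, 8, 9), (7, 14, 15), (8, 12, 13), (9, 11, 14), (9, 15, 16), (10, 11, 12), (10,
    13, 17), (11, 16, 17), (12, 17, 18), (13, 14, 16), (15, 19, 20), (18, 21, 22), (18, 23,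
    24), (19, 21, 24), (19, 22, 23), (20, 21, 23), (20, 22, 24)]
    [1, 3, 6, 9, 11, 12, 13, 15, 22, 23, 24]"
  by code_simp

lemma config_28_12:
  "base_config 28 6 12
    [(15, 16, 24), (20, 21, 27), (23, 25, 26)]
    [(0, 1, 2), (0, 3, 5), (0, 4, 6), (1, 3, 4), (1, 5, 7), (2, 3, 6), (2, 4, 5), (6, 14,
    15), (7, 8, 9), (7, 10, 12), (8, 10, 11), (8, 12, 13), (9, 10, 13), (9, 11, 12), (11,
    13, 14), (14, 16, 17), (15, 21, 22), (16, 18, 20), (17, 18, 19), (17, 22, 23), (18, 26,
    27), (19, 22, 26), (19, 25, 27), (20, 24, 25), (21, 23, 24)]
    [0, 2, 3, 7, 11, 13, 15, 17, 20, 23, 26, 27]"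
  by code_simp

section \<open>The two families\<close>

text \<open>The families starting at 12, 14 and 16 cover the residues 0, 2 and 1 modulo 3; the
  orders missed by them are 9, then 8 and 11, then 10 and 13.\<close>

lemma attains_ceiling_plus_1:
  assumes "v \<ge> 8"
  shows "attains_min_blocking v ((v + 2) div 3 + 1)"
proof -
  consider "v = 8" | "v = 9" | "v = 10" | "v = 11" | "v = 13"
    | n where "v = 12 + 3 * n" | n where "v = 14 + 3 * n" | n where "v = 16 + 3 * n"
  proof -
    have "v = 8 \<or> v = 9 \<or> v = 10 \<or> v = 11 \<or> v = 13 \<or>
      (\<exists>n. v = 12 + 3 * n) \<or> (\<exists>n. v = 14 + 3 * n) \<or> (\<exists>n. v = 16 + 3 * n)"
      using assms by presburger
    then show thesis using that by blast
  qed
  then show ?thesis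
  proof cases
    case 1 then show ?thesis using base_config_attains_min_blocking[OF config_8_4] by simp
  next
    case 2 then show ?thesis using base_config_attains_min_blocking[OF config_9_4] by simp
  next
    case 3 then show ?thesis using base_config_attains_min_blocking[OF config_10_5] by simp
  next
    case 4 then show ?thesis using base_config_attains_min_blocking[OF config_11_5] by simp
  next
    case 5 then show ?thesis using base_config_attains_min_blocking[OF config_13_6] by simp
  next
    case (6 n)
    then have "(v + 2) div 3 + 1 = 5 + n" by simp
    then show ?thesis using base_config_extendable[OF config_12_5, of n] 6 by simp
  next
    case (7 n)
    then have "(v + 2) div 3 + 1 = 6 + n" by simp
    then show ?thesis using base_config_extendable[OF config_14_6, of n] 7 by simp
  next
    case (8 n)
    then have "(v + 2) div 3 + 1 = 7 + n" by simp
    then show ?thesis using base_config_extendable[OF config_16_7, of n] 8 by simp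
  qed
qed

text \<open>The residues 0, 2 and 1 modulo 3 are covered from 18, 23 and 28 on; the eight smaller
  orders have configurations of their own.\<close>

lemma attains_ceiling_plus_2:
  assumes "v = 12 \<or> v \<ge> 15"
  shows "attains_min_blocking v ((v + 2) div 3 + 2)"
proof -
  consider "v = 12" | "v = 15" | "v = 16" | "v = 17" | "v = 19" | "v = 20" | "v = 22" | "v = 25"
    | n where "v = 18 + 3 * n" | n where "v = 23 + 3 * n" | n where "v = 28 + 3 * n"
  proof -
    have "v = 12 \<or> v = 15 \<or> v = 16 \<or> v = 17 \<or> v = 19 \<or> v = 20 \<or> v = 22 \<or> v = 25 \<or>
      (\<exists>n. v = 18 + 3 * n) \<or> (\<exists>n. v = 23 + 3 * n) \<or> (\<exists>n. v = 28 + 3 * n)"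
      using assms by presburger
    then show thesis using that by blast
  qed
  then show ?thesis
  proof cases
    case 1 then show ?thesis using base_config_attains_min_blocking[OF config_12_6] by simp
  next
    case 2 then show ?thesis using base_config_attains_min_blocking[OF config_15_7] by simp
  next
    case 3 then show ?thesis using base_config_attains_min_blocking[OF config_16_8] by simp
  next
    case 4 then show ?thesis using base_config_attains_min_blocking[OF config_17_8] by simp
  next
    case 5 then show ?thesis using base_config_attains_min_blocking[OF config_19_9] by simp
  next
    case 6 then show ?thesis using base_config_attains_min_blocking[OF config_20_9] by simp
  next
    case 7 then show ?thesis using base_config_attains_min_blocking[OF config_22_10] by simp
  next
    case 8 then show ?thesis using base_config_attains_min_blocking[OF config_25_11] by simp
  next
    case (9 n)
    then have "(v + 2) div 3 + 2 = 8 + n" by simp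
    then show ?thesis using base_config_extendable[OF config_18_8, of n] 9 by simp
  next
    case (10 n)
    then have "(v + 2) div 3 + 2 = 10 + n" by simp
    then show ?thesis using base_config_extendable[OF config_23_10, of n] 10 by simp
  next
    case (11 n)
    then have "(v + 2) div 3 + 2 = 12 + n" by simp
    then show ?thesis using base_config_extendable[OF config_28_12, of n] 11 by simp
  qed
qed

lemma nat_ceiling_third: "nat \<lceil>real v / 3\<rceil> = (v + 2) div 3"
proof -
  have "\<lceil>real v / 3\<rceil> = int ((v + 2) div 3)"
  proof (rule ceiling_unique)
    \<comment> \<open>Three times the two bounds that characterise the ceiling of
      \<open>v / 3\<close>.\<close>
    have "v \<le> 3 * ((v + 2) div 3)" "3 * ((v + 2) div 3) < v + 3" by linarith+
    then have "real v \<le> real (3 * ((v + 2) div 3))" "real (3 * ((v + 2) div 3)) < real (v + 3)"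
      by (simp_all only: of_nat_le_iff of_nat_less_iff)
    then show "real v / 3 \<le> of_int (int ((v + 2) div 3))" "of_int (int ((v + 2) div 3)) - 1 < real v / 3"
      by simp_all
  qed
  then show ?thesis by simp
qed

theorem mainTheorem3:
  shows "(\<forall>v::nat. v \<ge> 8 \<longrightarrow>
            (\<exists>(P::nat set) B. sym_config_v3 P B v \<and> config_connected P B \<and>
               min_blocking_card P B (nat \<lceil>real v / 3\<rceil> + 1)))
       \<and> (\<forall>v::nat. (v = 12 \<or> v \<ge> 15) \<longrightarrow>
            (\<exists>(P::nat set) B. sym_config_v3 P B v \<and> config_connected P B \<and>
               min_blocking_card P B (nat \<lceil>real v / 3\<rceil> + 2)))"
  using attains_ceiling_plus_1 attains_ceiling_plus_2
  unfolding attains_min_blocking_def nat_ceiling_third by blast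

end
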